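(* Set a step size $h>0$ and a time-scaling $\varepsilon>0$. Let $g:W\to\mathbb R\cup\{+\infty\}$ be a proper, convex, lower semicontinuous function and $\mathcal S=\partial g$. Let $\phi_h^{3*}=\psi_h^{2i}\circ\psi_h^{1e}$, where $\psi_h^{1e}$ is the explicit Euler step of size $h$ for $\varepsilon\dot w_1=-\mathcal A w_1-b$ and $\psi_h^{2i}$ is the implicit Euler step of size $h$ for $\varepsilon\dot w_2\in-\mathcal S w_2$. Then $$\phi_h^{3*}(w)=J_{\frac h\varepsilon\mathcal S}\bigl(w-\tfrac h\varepsilon\mathcal A(w)-\tfrac h\varepsilon b\bigr)=\operatorname{prox}_{\frac h\varepsilon g}\bigl(w-\tfrac h\varepsilon\mathcal A(w)-\tfrac h\varepsilon b\bigr)$$ for all $w\in W$. Hence, for an initial value $w_0\in W$, the sequences $(w_n)_{n\in\mathbb N}$ produced by the following update rules coincide: (i) explicit/implicit Euler for the optimizer system: $w_{n+1}=\phi_h^{3*}(w_n)$; (ii) forward-backward for $(\mathcal A+b)+\mathcal S$: $w_{n+1}=J_{\frac h\varepsilon\mathcal S}(w_n-\frac h\varepsilon\mathcal A(w_n)-\frac h\varepsilon b)$; (iii) proximal gradient: $w_{n+1}=\operatorname{prox}_{\frac h\varepsilon g}(w_n-\frac h\varepsilon\mathcal A(w_n)-\frac h\varepsilon b)$.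
   Context: $W$ is a Hilbert space, $\mathcal A:W\supset D(\mathcal A)\to W$ is a single-valued maximally monotone operator, and $b\in W$ is a given forcing term. $\partial g$ denotes the convex subdifferential of $g$. For $\mathcal M:W\rightrightarrows W$ and $\gamma>0$, the resolvent is $J_{\gamma\mathcal M}=(I+\gamma\mathcal M)^{-1}$, and $\operatorname{prox}_{\gamma g}=J_{\gamma\partial g}$. For $\varepsilon\dot w\in-\mathcal M(w)$, the explicit Euler step of size $h$ is $w\mapsto w-\frac h\varepsilon\mathcal M(w)$, and the implicit Euler step of size $h$ is $w\mapsto w_+$ with $w_+\in w-\frac h\varepsilon\mathcal M(w_+)$, i.e. $w_+=(I+\frac h\varepsilon\mathcal M)^{-1}w$. *)

theory Defs
  imports "HOL-Analysis.Analysis"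
begin

text \<open>A set-valued operator on \<open>W\<close> is a function into sets; its domain is
  the set of points where the value is nonempty.\<close>

type_synonym 'a set_op = "'a \<Rightarrow> 'a set"

text \<open>The single-valued operator with domain \<open>D\<close>: the values of \<open>A\<close> outside \<open>D\<close> are ignored.\<close>

definition op_on :: "'a set \<Rightarrow> ('a \<Rightarrow> 'a) \<Rightarrow> 'a set_op" where
  "op_on D A x = (if x \<in> D then {A x} else {})"

definition monotone_op :: "'a::real_inner set_op \<Rightarrow> bool" where
  "monotone_op M \<longleftrightarrow> (\<forall>x y. \<forall>u \<in> M x. \<forall>v \<in> M y. 0 \<le> (x - y) \<bullet> (u - v))"

definition maximally_monotone :: "'a::real_inner set_op \<Rightarrow> bool" where
  "maximally_monotone M \<longleftrightarrow>
     monotone_op M \<and> (\<forall>N. monotone_op N \<and> (\<forall>x. M x \<subseteq> N x) \<longrightarrow> N = M)"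

text \<open>Functions \<open>g : W \<rightarrow> \<real> \<union> {+\<infinity>}\<close> are \<open>ereal\<close>-valued; that \<open>-\<infinity>\<close> is not a value
  is part of properness.\<close>

definition proper_fun :: "('a \<Rightarrow> ereal) \<Rightarrow> bool" where
  "proper_fun g \<longleftrightarrow> (\<forall>x. g x \<noteq> - \<infinity>) \<and> (\<exists>x. g x \<noteq> \<infinity>)"

text \<open>At \<open>t = 0\<close> and \<open>t = 1\<close> the \<open>ereal\<close> convention \<open>0 * \<infinity> = 0\<close> makes the inequality trivial.\<close>

definition convex_fun :: "('a::real_vector \<Rightarrow> ereal) \<Rightarrow> bool" where
  "convex_fun g \<longleftrightarrow> (\<forall>x y. \<forall>t \<in> {0..1}.
     g ((1 - t) *\<^sub>R x + t *\<^sub>R y) \<le> ereal (1 - t) * g x + ereal t * g y)"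

definition lower_semicont :: "('a::topological_space \<Rightarrow> ereal) \<Rightarrow> bool" where
  "lower_semicont g \<longleftrightarrow> (\<forall>x. g x \<le> Liminf (at x) g)"

text \<open>For proper \<open>g\<close> this set is empty wherever \<open>g x = \<infinity>\<close>.\<close>

definition subdifferential :: "('a::real_inner \<Rightarrow> ereal) \<Rightarrow> 'a set_op" where
  "subdifferential g x = {u. \<forall>y. g x + ereal (u \<bullet> (y - x)) \<le> g y}"

definition op_inverse :: "'a set_op \<Rightarrow> 'a set_op" where
  "op_inverse M y = {x. y \<in> M x}"

definition resolvent_set :: "real \<Rightarrow> 'a::real_vector set_op \<Rightarrow> 'a set_op" where
  "resolvent_set \<gamma> M = op_inverse (\<lambda>x. {x + \<gamma> *\<^sub>R u | u. u \<in> M x})"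

text \<open>The point-valued resolvent and implicit Euler step below select the unique element of the
  underlying set-valued map, so they are meaningful only where that set is a singleton.\<close>

definition resolvent :: "real \<Rightarrow> 'a::real_vector set_op \<Rightarrow> 'a \<Rightarrow> 'a" where
  "resolvent \<gamma> M v = the_elem (resolvent_set \<gamma> M v)"

definition prox :: "real \<Rightarrow> ('a::real_inner \<Rightarrow> ereal) \<Rightarrow> 'a \<Rightarrow> 'a" where
  "prox \<gamma> g = resolvent \<gamma> (subdifferential g)"

text \<open>Euler steps of size \<open>h\<close> for \<open>\<epsilon> w' \<in> - M w\<close>; the explicit one for point-valued \<open>M\<close>.\<close>

definition explicit_euler :: "real \<Rightarrow> real \<Rightarrow> ('a \<Rightarrow> 'a) \<Rightarrow> 'a::real_vector \<Rightarrow> 'a" where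
  "explicit_euler h \<epsilon> M w = w - (h / \<epsilon>) *\<^sub>R M w"

definition implicit_euler_set :: "real \<Rightarrow> real \<Rightarrow> 'a::real_vector set_op \<Rightarrow> 'a set_op" where
  "implicit_euler_set h \<epsilon> M w = {w'. w' \<in> {w - (h / \<epsilon>) *\<^sub>R u | u. u \<in> M w'}}"

definition implicit_euler :: "real \<Rightarrow> real \<Rightarrow> 'a::real_vector set_op \<Rightarrow> 'a \<Rightarrow> 'a" where
  "implicit_euler h \<epsilon> M w = the_elem (implicit_euler_set h \<epsilon> M w)"

end

theory Submission
  imports Defs
begin

text \<open>
  Both step maps, and the resolvent, solve the same inclusion: \<open>w\<close> belongs to the implicit Euler set
  at \<open>v\<close> iff \<open>v = w + (h / \<epsilon>) u\<close> for some \<open>u \<in> S w\<close>. So the three update rules agree as soon as the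
  underlying set-valued maps do. What has content is that these maps are
  everywhere singletons, that is, that the proximal point exists and is unique.

  Uniqueness is monotonicity of the subdifferential. For existence, the objective
  \<open>F x = g x + (norm (x - v))\<^sup>2 / (2 \<gamma>)\<close> is minimized. It is bounded below, because a convex function
  that is lower semicontinuous at one point of its domain decreases at most linearly
  (\<open>convex_lower_bound\<close>), which the quadratic term outweighs. By the parallelogram law, sublevel sets of \<open>F\<close> near its infimum have small diameter, so
  completeness yields a point common to all of them, which is a minimizer (\<open>prox_minimizer_exists\<close>).
  Comparing the minimizer \<open>p\<close> with nearby points on segments issuing from it then gives
  \<open>(v - p) / \<gamma> \<in> \<partial>g p\<close> (\<open>prox_minimizer_subgradient\<close>).

  The minimization is carried out for a real-valued function \<open>f\<close> on a convex set \<open>C\<close>, the effective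
  domain of \<open>g\<close>; lower semicontinuity of \<open>g\<close> enters as closedness of the sublevel sets of \<open>f\<close> in the
  whole space.
\<close>

section \<open>Minimizing a convex function plus a squared distance\<close>

text \<open>The value of \<open>f\<close> on a small ball about \<open>x0\<close> is at least \<open>f x0 - 1\<close>. A point \<open>x\<close> outside the ball
  is joined to \<open>x0\<close> by a segment which crosses the ball at a fixed distance from \<open>x0\<close>; convexity
  extrapolates the bound there linearly to \<open>x\<close>.\<close>

lemma convex_lower_bound:
  fixes f :: "'a::real_normed_vector \<Rightarrow> real"
  assumes cvx: "convex_on C f" and x0: "x0 \<in> C" and cl: "closed {x \<in> C. f x \<le> f x0 - 1}"
  obtains r where "r > 0" "\<And>x. x \<in> C \<Longrightarrow> f x0 - 1 - norm (x - x0) / r \<le> f x"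
proof -
  have "open (- {x \<in> C. f x \<le> f x0 - 1})" using cl by (rule open_Compl)
  moreover have "x0 \<in> - {x \<in> C. f x \<le> f x0 - 1}" by simp
  ultimately obtain d where d: "d > 0" "cball x0 d \<subseteq> - {x \<in> C. f x \<le> f x0 - 1}"
    using open_contains_cball by blast
  have near: "f x0 - 1 < f x" if "x \<in> C" "norm (x - x0) \<le> d" for x
  proof -
    have "x \<in> cball x0 d" using that by (simp add: dist_norm norm_minus_commute)
    then show ?thesis using d that by force
  qed
  show thesis
  proof (rule that[OF d(1)])
    fix x assume x: "x \<in> C"
    show "f x0 - 1 - norm (x - x0) / d \<le> f x"
    proof (cases "norm (x - x0) \<le> d")
      case True
      have "0 \<le> norm (x - x0) / d" using d by simp
      then show ?thesis using near[OF x True] by linarith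
    next
      case False
      define t where "t = d / norm (x - x0)"
      have n: "norm (x - x0) > 0" using False d by linarith
      have t: "0 < t" "t < 1" using False d n by (auto simp: t_def)
      let ?y = "(1 - t) *\<^sub>R x0 + t *\<^sub>R x"
      have "?y - x0 = t *\<^sub>R (x - x0)" by (simp add: algebra_simps)
      then have "norm (?y - x0) = d" using d n by (simp add: t_def)
      moreover have "?y \<in> C"
        using convex_on_imp_convex[OF cvx] x0 x t by (simp add: convex_alt)
      ultimately have "f x0 - 1 < f ?y" using near by simp
      also have "f ?y \<le> (1 - t) * f x0 + t * f x"
        using convex_onD[OF cvx] t x x0 by simp
      finally have "t * (f x0 - f x) < 1" by (simp add: algebra_simps)
      then have "f x0 - f x < 1 / t" using t by (simp add: field_simps)
      then show ?thesis by (simp add: t_def)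
    qed
  qed
qed

lemma prox_objective_bounded_below:
  fixes f :: "'a::real_normed_vector \<Rightarrow> real"
  assumes cvx: "convex_on C f" and x0: "x0 \<in> C" and cl: "closed {x \<in> C. f x \<le> f x0 - 1}"
    and \<gamma>: "\<gamma> > 0"
  obtains B where "\<And>x. x \<in> C \<Longrightarrow> B \<le> f x + (norm (x - v))\<^sup>2 / (2 * \<gamma>)"
proof -
  obtain r where r: "r > 0" "\<And>x. x \<in> C \<Longrightarrow> f x0 - 1 - norm (x - x0) / r \<le> f x"
    using convex_lower_bound[OF cvx x0 cl] by blast
  show thesis
  proof (rule that)
    fix x assume x: "x \<in> C"
    define s where "s = norm (x - v)"
    have "norm (x - x0) \<le> s + norm (v - x0)"
      unfolding s_def using norm_triangle_ineq[of "x - v" "v - x0"] by simp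
    then have "norm (x - x0) / r \<le> s / r + norm (v - x0) / r"
      using r(1) by (simp add: field_simps)
    moreover have "s / r \<le> s\<^sup>2 / (2 * \<gamma>) + \<gamma> / (2 * r\<^sup>2)"
    proof -
      have "0 \<le> (s - \<gamma> / r)\<^sup>2 / (2 * \<gamma>)" using \<gamma> by simp
      also have "\<dots> = s\<^sup>2 / (2 * \<gamma>) + \<gamma> / (2 * r\<^sup>2) - s / r"
        using \<gamma> r(1) by (simp add: power2_eq_square field_simps)
      finally show ?thesis by simp
    qed
    ultimately show "f x0 - 1 - norm (v - x0) / r - \<gamma> / (2 * r\<^sup>2)
        \<le> f x + (norm (x - v))\<^sup>2 / (2 * \<gamma>)"
      using r(2)[OF x] unfolding s_def by linarith
  qed
qed

lemma closed_sublevel_add_continuous: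
  fixes f q :: "'a::metric_space \<Rightarrow> real"
  assumes cl: "\<And>c. closed {x \<in> C. f x \<le> c}" and q: "continuous_on UNIV q"
  shows "closed {x \<in> C. f x + q x \<le> c}"
  unfolding closed_sequential_limits
proof (intro allI impI)
  fix X p assume X: "(\<forall>n. X n \<in> {x \<in> C. f x + q x \<le> c}) \<and> X \<longlonglongrightarrow> p"
  have lim: "(\<lambda>n. q (X n)) \<longlonglongrightarrow> q p"
    using X q by (intro continuous_on_tendsto_compose[of UNIV q]) auto
  have p: "p \<in> {x \<in> C. f x \<le> c - q p + e}" if e: "e > 0" for e
  proof (rule Lim_in_closed_set[OF cl])
    have "\<forall>\<^sub>F n in sequentially. q p - e < q (X n)"
      using e by (intro order_tendstoD(1)[OF lim]) simp
    then show "\<forall>\<^sub>F n in sequentially. X n \<in> {x \<in> C. f x \<le> c - q p + e}"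
    proof eventually_elim
      case (elim n)
      have "X n \<in> C" "f (X n) + q (X n) \<le> c" using X by auto
      then show ?case using elim by simp
    qed
  qed (use X in auto)
  have "f p \<le> c - q p" by (rule field_le_epsilon) (use p in auto)
  moreover have "p \<in> C" using p[of 1] by simp
  ultimately show "p \<in> {x \<in> C. f x + q x \<le> c}" by simp
qed

text \<open>The midpoint of two points where the objective is within \<open>e\<close> of its infimum has, by the
  parallelogram law, a value lower than their average by a multiple of their squared distance.
  Hence the nearly optimal points form closed sets whose diameters shrink to zero.\<close>

lemma prox_minimizer_exists:
  fixes f :: "'a::{real_inner, complete_space} \<Rightarrow> real"
  assumes cvx: "convex_on C f" and ne: "C \<noteq> {}" and cl: "\<And>c. closed {x \<in> C. f x \<le> c}"
    and \<gamma>: "\<gamma> > 0"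
  obtains p where "p \<in> C"
    "\<And>x. x \<in> C \<Longrightarrow> f p + (norm (p - v))\<^sup>2 / (2 * \<gamma>) \<le> f x + (norm (x - v))\<^sup>2 / (2 * \<gamma>)"
proof -
  define q where "q = (\<lambda>x. (norm (x - v))\<^sup>2 / (2 * \<gamma>))"
  define F where "F = (\<lambda>x. f x + q x)"
  obtain x0 where "x0 \<in> C" using ne by blast
  then obtain B where B: "\<And>x. x \<in> C \<Longrightarrow> B \<le> F x"
    using prox_objective_bounded_below[OF cvx _ cl \<gamma>, of x0 v] unfolding F_def q_def by blast
  define m where "m = Inf (F ` C)"
  have bdd: "bdd_below (F ` C)" using B by (intro bdd_belowI2)
  have m_le: "m \<le> F x" if "x \<in> C" for x
    unfolding m_def using bdd that by (rule cINF_lower)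
  have m_approx: "\<exists>x\<in>C. F x < m + e" if "e > 0" for e
    using cINF_less_iff[OF ne bdd, of "m + e"] that unfolding m_def by simp
  define T where "T = (\<lambda>n. {x \<in> C. F x \<le> m + 1 / Suc n})"
  have clT: "closed (T n)" for n
    unfolding T_def F_def
    by (intro closed_sublevel_add_continuous cl) (use \<gamma> in \<open>auto simp: q_def intro!: continuous_intros\<close>)
  have neT: "T n \<noteq> {}" for n
    using m_approx[of "1 / Suc n"] unfolding T_def by force
  have decT: "T n \<subseteq> T k" if "k \<le> n" for k n
  proof -
    have "1 / real (Suc n) \<le> 1 / real (Suc k)" using that by (simp add: field_simps)
    then show ?thesis unfolding T_def by auto
  qed
  have mid: "(norm (x - y))\<^sup>2 \<le> 8 * \<gamma> * e"
    if x: "x \<in> C" "F x \<le> m + e" and y: "y \<in> C" "F y \<le> m + e" for x y e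
  proof -
    let ?z = "(1 - 1/2) *\<^sub>R x + (1/2) *\<^sub>R y"
    have "?z \<in> C" using convexD_alt[OF convex_on_imp_convex[OF cvx] x(1) y(1), of "1/2"] by simp
    then have "m \<le> F ?z" by (rule m_le)
    moreover have "f ?z \<le> (1 - 1/2) * f x + (1/2) * f y"
      by (rule convex_onD[OF cvx]) (use x y in auto)
    moreover have "q ?z = q x / 2 + q y / 2 - (norm (x - y))\<^sup>2 / (8 * \<gamma>)"
    proof -
      have "4 * (norm (?z - v))\<^sup>2 = 2 * (norm (x - v))\<^sup>2 + 2 * (norm (y - v))\<^sup>2 - (norm (x - y))\<^sup>2"
        by (simp add: power2_norm_eq_inner algebra_simps inner_commute)
      then have "(norm (?z - v))\<^sup>2
          = (2 * (norm (x - v))\<^sup>2 + 2 * (norm (y - v))\<^sup>2 - (norm (x - y))\<^sup>2) / 4"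
        by (simp only: nonzero_eq_divide_eq mult.commute)
      then show ?thesis
        unfolding q_def by (simp only:) (simp add: add_divide_distrib diff_divide_distrib)
    qed
    ultimately have "(norm (x - y))\<^sup>2 / (8 * \<gamma>) \<le> e" using x(2) y(2) unfolding F_def by argo
    then show ?thesis using \<gamma> by (simp add: field_simps)
  qed
  have small: "\<exists>n. \<forall>x\<in>T n. \<forall>y\<in>T n. dist x y < e" if e: "e > 0" for e
  proof -
    obtain n where n: "8 * \<gamma> / e\<^sup>2 < real (Suc n)"
      using reals_Archimedean2 by (metis less_trans of_nat_less_iff lessI)
    have "8 * \<gamma> * (1 / Suc n) < e\<^sup>2" using n e by (simp add: field_simps del: of_nat_Suc)
    then have "(norm (x - y))\<^sup>2 < e\<^sup>2" if "x \<in> T n" "y \<in> T n" for x y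
      using mid[of x "1 / Suc n" y] that unfolding T_def by force
    then show ?thesis using e power2_less_imp_less[of _ e] unfolding dist_norm by (meson less_imp_le)
  qed
  obtain p where p: "\<And>n. p \<in> T n"
    using decreasing_closed_nest[of T, OF clT neT decT small] by blast
  have "F p \<le> m"
  proof (rule field_le_epsilon)
    fix e :: real assume "e > 0"
    then obtain n where "1 / real (Suc n) < e" using nat_approx_posE by blast
    then show "F p \<le> m + e" using p[of n] unfolding T_def by simp
  qed
  moreover have "p \<in> C" using p[of 0] unfolding T_def by simp
  ultimately show thesis using that m_le unfolding F_def q_def by (meson order_trans)
qed

text \<open>Along the segment from \<open>p\<close> to \<open>y\<close> the squared distance to \<open>v\<close> changes by its first-order term
  \<open>2 t ((p - v) \<bullet> (y - p))\<close> up to an error of order \<open>t\<^sup>2\<close>, whereas convexity bounds the change of \<open>f\<close> by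
  \<open>t (f y - f p)\<close>; dividing the minimality inequality by \<open>t\<close> and letting \<open>t\<close> tend to zero isolates the
  subgradient inequality.\<close>

lemma prox_minimizer_subgradient:
  fixes f :: "'a::real_inner \<Rightarrow> real"
  assumes cvx: "convex_on C f" and p: "p \<in> C" and y: "y \<in> C" and \<gamma>: "\<gamma> > 0"
    and min: "\<And>x. x \<in> C \<Longrightarrow>
      f p + (norm (p - v))\<^sup>2 / (2 * \<gamma>) \<le> f x + (norm (x - v))\<^sup>2 / (2 * \<gamma>)"
  shows "f p + ((1 / \<gamma>) *\<^sub>R (v - p)) \<bullet> (y - p) \<le> f y"
proof -
  let ?a = "f p + ((1 / \<gamma>) *\<^sub>R (v - p)) \<bullet> (y - p)"
  have step: "?a \<le> f y + t * ((norm (y - p))\<^sup>2 / (2 * \<gamma>))" if t: "0 < t" "t < 1" for t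
  proof -
    let ?z = "(1 - t) *\<^sub>R p + t *\<^sub>R y"
    have "?z \<in> C" using convexD_alt[OF convex_on_imp_convex[OF cvx] p y] t by simp
    then have "f p + (norm (p - v))\<^sup>2 / (2 * \<gamma>) \<le> f ?z + (norm (?z - v))\<^sup>2 / (2 * \<gamma>)" by (rule min)
    moreover have "f ?z \<le> (1 - t) * f p + t * f y"
      using convex_onD[OF cvx] t p y by simp
    moreover have "(norm (?z - v))\<^sup>2 / (2 * \<gamma>) = (norm (p - v))\<^sup>2 / (2 * \<gamma>)
        - t * (((1 / \<gamma>) *\<^sub>R (v - p)) \<bullet> (y - p)) + t * (t * ((norm (y - p))\<^sup>2 / (2 * \<gamma>)))"
    proof -
      have "?z - v = (p - v) + t *\<^sub>R (y - p)" by (simp add: algebra_simps)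
      then have "(norm (?z - v))\<^sup>2
          = (norm (p - v))\<^sup>2 - 2 * t * ((v - p) \<bullet> (y - p)) + t * t * (norm (y - p))\<^sup>2"
        unfolding power2_norm_eq_inner by (simp add: algebra_simps inner_commute)
      then show ?thesis using \<gamma> by (simp add: add_divide_distrib diff_divide_distrib)
    qed
    ultimately have "t * ?a \<le> t * (f y + t * ((norm (y - p))\<^sup>2 / (2 * \<gamma>)))"
      by (simp add: algebra_simps)
    then show ?thesis using t by simp
  qed
  have "((\<lambda>t. f y + t * ((norm (y - p))\<^sup>2 / (2 * \<gamma>))) \<longlongrightarrow> f y + 0 * ((norm (y - p))\<^sup>2 / (2 * \<gamma>)))
      (at_right 0)"
    by (intro tendsto_intros)
  moreover have "\<forall>\<^sub>F t in at_right 0. ?a \<le> f y + t * ((norm (y - p))\<^sup>2 / (2 * \<gamma>))"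
    unfolding eventually_at_right_field using step by (intro exI[of _ 1]) auto
  ultimately show ?thesis
    using tendsto_lowerbound[of _ _ "at_right (0::real)" ?a] by fastforce
qed

section \<open>The resolvent of a convex subdifferential\<close>

text \<open>The limit inferior defining lower semicontinuity is taken over punctured neighbourhoods; the
  centre lies in the strict superlevel set by assumption.\<close>

lemma closed_sublevel_lower_semicont:
  assumes "lower_semicont g"
  shows "closed {x. g x \<le> c}"
proof -
  have "open {x. c < g x}"
    unfolding open_subopen[of "{x. c < g x}"]
  proof
    fix x assume x: "x \<in> {x. c < g x}"
    then have "c < Liminf (at x) g"
      using assms unfolding lower_semicont_def by (auto intro: less_le_trans)
    then have "\<forall>\<^sub>F y in at x. c < g y" by (rule less_LiminfD)
    then have "\<forall>\<^sub>F y in nhds x. c < g y"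
      using x unfolding eventually_at_filter by (auto elim: eventually_mono)
    then show "\<exists>T. open T \<and> x \<in> T \<and> T \<subseteq> {x. c < g x}"
      unfolding eventually_nhds by blast
  qed
  moreover have "- {x. c < g x} = {x. g x \<le> c}" by auto
  ultimately show ?thesis by (metis closed_def double_complement)
qed

lemma proper_fun_ereal_real:
  assumes "proper_fun g" "g x \<noteq> \<infinity>"
  shows "g x = ereal (real_of_ereal (g x))"
  using assms unfolding proper_fun_def by (metis ereal_real' ereal_infinity_cases)

lemma convex_on_effective_domain:
  assumes pr: "proper_fun g" and cvx: "convex_fun g"
  shows "convex_on {x. g x \<noteq> \<infinity>} (\<lambda>x. real_of_ereal (g x))"
proof -
  have *: "g ((1 - t) *\<^sub>R x + t *\<^sub>R y)
      \<le> ereal ((1 - t) * real_of_ereal (g x) + t * real_of_ereal (g y))"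
    if t: "t \<in> {0..1}" and "g x \<noteq> \<infinity>" "g y \<noteq> \<infinity>" for x y t
  proof -
    have "g ((1 - t) *\<^sub>R x + t *\<^sub>R y) \<le> ereal (1 - t) * g x + ereal t * g y"
      using cvx t unfolding convex_fun_def by blast
    also have "\<dots> = ereal (1 - t) * ereal (real_of_ereal (g x))
        + ereal t * ereal (real_of_ereal (g y))"
      using proper_fun_ereal_real[OF pr] that by metis
    finally show ?thesis by simp
  qed
  have fin: "g ((1 - t) *\<^sub>R x + t *\<^sub>R y) \<noteq> \<infinity>"
    if "t \<in> {0..1}" "g x \<noteq> \<infinity>" "g y \<noteq> \<infinity>" for x y t
    using *[OF that] by auto
  show ?thesis
  proof (rule convex_onI)
    show "convex {x. g x \<noteq> \<infinity>}" unfolding convex_alt using fin by auto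
    fix t :: real and x y
    assume t: "0 < t" "t < 1" and xy: "x \<in> {x. g x \<noteq> \<infinity>}" "y \<in> {x. g x \<noteq> \<infinity>}"
    then have "ereal (real_of_ereal (g ((1 - t) *\<^sub>R x + t *\<^sub>R y)))
        \<le> ereal ((1 - t) * real_of_ereal (g x) + t * real_of_ereal (g y))"
      using *[of t x y] fin[of t x y] proper_fun_ereal_real[OF pr] by auto
    then show "real_of_ereal (g ((1 - t) *\<^sub>R x + t *\<^sub>R y))
        \<le> (1 - t) * real_of_ereal (g x) + t * real_of_ereal (g y)" by simp
  qed
qed

lemma subdifferential_finite:
  assumes pr: "proper_fun g" and u: "u \<in> subdifferential g x"
  shows "g x \<noteq> \<infinity>"
proof
  assume "g x = \<infinity>"
  then have "g y = \<infinity>" for y using u unfolding subdifferential_def by (auto split: if_splits)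
  then show False using pr unfolding proper_fun_def by blast
qed

lemma monotone_subdifferential:
  assumes pr: "proper_fun g"
  shows "monotone_op (subdifferential g)"
  unfolding monotone_op_def
proof (intro allI ballI)
  fix x y u v assume u: "u \<in> subdifferential g x" and v: "v \<in> subdifferential g y"
  obtain a b where ab: "g x = ereal a" "g y = ereal b"
    using subdifferential_finite[OF pr u] subdifferential_finite[OF pr v]
      proper_fun_ereal_real[OF pr] by meson
  have "g x + ereal (u \<bullet> (y - x)) \<le> g y" "g y + ereal (v \<bullet> (x - y)) \<le> g x"
    using u v unfolding subdifferential_def by auto
  then have "a + u \<bullet> (y - x) \<le> b" "b + v \<bullet> (x - y) \<le> a" by (simp_all add: ab)
  then show "0 \<le> (x - y) \<bullet> (u - v)" by (simp add: algebra_simps inner_commute)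
qed

lemma resolvent_set_iff:
  assumes "\<gamma> > 0"
  shows "w \<in> resolvent_set \<gamma> M v \<longleftrightarrow> (1 / \<gamma>) *\<^sub>R (v - w) \<in> M w"
proof -
  have "v = w + \<gamma> *\<^sub>R u \<longleftrightarrow> u = (1 / \<gamma>) *\<^sub>R (v - w)" for u
  proof
    assume "u = (1 / \<gamma>) *\<^sub>R (v - w)"
    then show "v = w + \<gamma> *\<^sub>R u" using assms by simp
  qed (use assms in simp)
  then show ?thesis unfolding resolvent_set_def op_inverse_def by auto
qed

text \<open>If \<open>w\<close> and \<open>w'\<close> both belong to the resolvent set at \<open>v\<close>, monotonicity applied to the values
  \<open>(v - w) / \<gamma>\<close> and \<open>(v - w') / \<gamma>\<close> leaves \<open>0 \<le> - (norm (w - w'))\<^sup>2 / \<gamma>\<close>.\<close>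

lemma resolvent_set_unique:
  assumes mono: "monotone_op M" and \<gamma>: "\<gamma> > 0"
    and w: "w \<in> resolvent_set \<gamma> M v" "w' \<in> resolvent_set \<gamma> M v"
  shows "w = w'"
proof -
  have "0 \<le> (w - w') \<bullet> ((1 / \<gamma>) *\<^sub>R (v - w) - (1 / \<gamma>) *\<^sub>R (v - w'))"
    using mono w unfolding resolvent_set_iff[OF \<gamma>] monotone_op_def by blast
  also have "\<dots> = - ((w - w') \<bullet> (w - w')) / \<gamma>"
    using \<gamma> by (simp add: field_simps inner_diff_left inner_diff_right)
  finally have "(w - w') \<bullet> (w - w') \<le> 0" using \<gamma> by (simp add: field_simps)
  then show ?thesis by (simp flip: power2_norm_eq_inner)
qed

lemma resolvent_set_subdifferential_nonempty:
  fixes g :: "'a::{real_inner, complete_space} \<Rightarrow> ereal"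
  assumes pr: "proper_fun g" and cvx: "convex_fun g" and lsc: "lower_semicont g" and \<gamma>: "\<gamma> > 0"
  obtains w where "w \<in> resolvent_set \<gamma> (subdifferential g) v"
proof -
  define f where "f = (\<lambda>x. real_of_ereal (g x))"
  let ?C = "{x. g x \<noteq> \<infinity>}"
  have gf: "g x = ereal (f x)" if "x \<in> ?C" for x
    using proper_fun_ereal_real[OF pr] that unfolding f_def by simp
  have cvxf: "convex_on ?C f" unfolding f_def using pr cvx by (rule convex_on_effective_domain)
  have "x \<in> ?C \<and> f x \<le> c \<longleftrightarrow> g x \<le> ereal c" for x c
    using gf[of x] by (cases "g x = \<infinity>") auto
  then have "{x \<in> ?C. f x \<le> c} = {x. g x \<le> ereal c}" for c
    by blast
  then have cl: "closed {x \<in> ?C. f x \<le> c}" for c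
    using closed_sublevel_lower_semicont[OF lsc] by simp
  have ne: "?C \<noteq> {}" using pr unfolding proper_fun_def by auto
  obtain p where p: "p \<in> ?C"
    "\<And>x. x \<in> ?C \<Longrightarrow> f p + (norm (p - v))\<^sup>2 / (2 * \<gamma>) \<le> f x + (norm (x - v))\<^sup>2 / (2 * \<gamma>)"
    using prox_minimizer_exists[OF cvxf ne cl \<gamma>] by blast
  have "g p + ereal (((1 / \<gamma>) *\<^sub>R (v - p)) \<bullet> (y - p)) \<le> g y" for y
  proof (cases "y \<in> ?C")
    case True
    show ?thesis
      using prox_minimizer_subgradient[OF cvxf p(1) True \<gamma> p(2)] gf[OF p(1)] gf[OF True] by simp
  qed simp
  then show thesis
    using that[of p] unfolding resolvent_set_iff[OF \<gamma>] subdifferential_def by blast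
qed

lemma resolvent_set_subdifferential_ex1:
  fixes g :: "'a::{real_inner, complete_space} \<Rightarrow> ereal"
  assumes "proper_fun g" "convex_fun g" "lower_semicont g" "\<gamma> > 0"
  shows "\<exists>!w. w \<in> resolvent_set \<gamma> (subdifferential g) v"
  using resolvent_set_subdifferential_nonempty[OF assms]
    resolvent_set_unique[OF monotone_subdifferential[OF assms(1)] assms(4)] by blast

section \<open>Euler steps as forward-backward steps\<close>

lemma implicit_euler_set_eq_resolvent_set:
  fixes M :: "'a::real_vector set_op"
  shows "implicit_euler_set h \<epsilon> M = resolvent_set (h / \<epsilon>) M"
proof
  fix v
  have "w = v - (h / \<epsilon>) *\<^sub>R u \<longleftrightarrow> v = w + (h / \<epsilon>) *\<^sub>R u" for w u :: 'a
    by (subst eq_diff_eq) (rule eq_commute)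
  then show "implicit_euler_set h \<epsilon> M v = resolvent_set (h / \<epsilon>) M v"
    unfolding implicit_euler_set_def resolvent_set_def op_inverse_def by simp
qed

lemma implicit_euler_eq_resolvent: "implicit_euler h \<epsilon> M = resolvent (h / \<epsilon>) M"
  unfolding implicit_euler_def resolvent_def implicit_euler_set_eq_resolvent_set ..

lemma recursion_unique:
  assumes "x 0 = y 0" "\<And>n. x (Suc n) = T (x n)" "\<And>n. y (Suc n) = T (y n)"
  shows "x = y"
proof
  show "x n = y n" for n by (induction n) (simp_all add: assms)
qed

theorem theorem5p2:
  fixes A :: "'a::{real_inner, complete_space} \<Rightarrow> 'a" and D :: "'a set" and b :: 'a
    and g :: "'a \<Rightarrow> ereal" and S :: "'a set_op" and \<phi> :: "'a \<Rightarrow> 'a" and h \<epsilon> :: real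
  assumes A_max: "maximally_monotone (op_on D A)"
    and h_pos: "h > 0" and eps_pos: "\<epsilon> > 0"
    and g_proper: "proper_fun g" and g_convex: "convex_fun g" and g_lsc: "lower_semicont g"
    and S_eq: "S = subdifferential g"
    and phi_eq: "\<phi> = implicit_euler h \<epsilon> S \<circ> explicit_euler h \<epsilon> (\<lambda>w. A w + b)"
  shows "(\<forall>v. \<exists>!w. w \<in> implicit_euler_set h \<epsilon> S v) \<and>
         (\<forall>v. \<exists>!w. w \<in> resolvent_set (h / \<epsilon>) S v) \<and>
         (\<forall>w. \<phi> w = resolvent (h / \<epsilon>) S (w - (h / \<epsilon>) *\<^sub>R A w - (h / \<epsilon>) *\<^sub>R b) \<and>
              resolvent (h / \<epsilon>) S (w - (h / \<epsilon>) *\<^sub>R A w - (h / \<epsilon>) *\<^sub>R b)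
                = prox (h / \<epsilon>) g (w - (h / \<epsilon>) *\<^sub>R A w - (h / \<epsilon>) *\<^sub>R b)) \<and>
         (\<forall>w0. \<forall>x y z :: nat \<Rightarrow> 'a.
              x 0 = w0 \<and> (\<forall>n. x (Suc n) = \<phi> (x n)) \<and>
              y 0 = w0 \<and> (\<forall>n. y (Suc n) =
                resolvent (h / \<epsilon>) S (y n - (h / \<epsilon>) *\<^sub>R A (y n) - (h / \<epsilon>) *\<^sub>R b)) \<and>
              z 0 = w0 \<and> (\<forall>n. z (Suc n) =
                prox (h / \<epsilon>) g (z n - (h / \<epsilon>) *\<^sub>R A (z n) - (h / \<epsilon>) *\<^sub>R b))
              \<longrightarrow> x = y \<and> y = z)"
proof -
  let ?v = "\<lambda>w. w - (h / \<epsilon>) *\<^sub>R A w - (h / \<epsilon>) *\<^sub>R b"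
  have ex1: "\<exists>!w. w \<in> resolvent_set (h / \<epsilon>) S v" for v
    unfolding S_eq
    using g_proper g_convex g_lsc h_pos eps_pos by (intro resolvent_set_subdifferential_ex1) simp_all
  have phi: "\<phi> w = resolvent (h / \<epsilon>) S (?v w)" for w
    unfolding phi_eq implicit_euler_eq_resolvent explicit_euler_def
    by (simp add: scaleR_add_right diff_diff_eq)
  have prox: "prox (h / \<epsilon>) g = resolvent (h / \<epsilon>) S" unfolding prox_def S_eq ..
  have seq: "x = y \<and> y = z"
    if "x 0 = w0" "\<forall>n. x (Suc n) = \<phi> (x n)"
      "y 0 = w0" "\<forall>n. y (Suc n) = resolvent (h / \<epsilon>) S (?v (y n))"
      "z 0 = w0" "\<forall>n. z (Suc n) = prox (h / \<epsilon>) g (?v (z n))" for w0 and x y z :: "nat \<Rightarrow> 'a"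
    using that recursion_unique[of x y "\<lambda>w. resolvent (h / \<epsilon>) S (?v w)"]
      recursion_unique[of y z "\<lambda>w. resolvent (h / \<epsilon>) S (?v w)"]
    by (simp add: phi prox)
  show ?thesis
    unfolding implicit_euler_set_eq_resolvent_set prox
    using ex1 phi seq[unfolded prox] by blast
qed

end
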